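(* There is an absolute constant $C>0$ such that for all integers $n\geq 1$ and $r\ge 1$ with $\sqrt{n\log n}\leq r\leq n$, \[ P\big(\ell_r(\bar Z)=n\big)=\frac{\mathrm{e}^{-\gamma}}{r}\,\rho\Big(\frac{n}{r}\Big)(1+\varepsilon_{n,r}),\qquad |\varepsilon_{n,r}|\leq \frac{Cn\log(n/r+1)}{r^2}. \]
   Context: $\log$ is the natural logarithm and $\gamma$ is the Euler--Mascheroni constant. $Z_1,Z_2,\dots$ are independent Poisson random variables with $\mathbf{E}Z_j=1/j$, and $\ell_r(\bar Z)=1Z_1+2Z_2+\cdots+rZ_r$. $\rho$ is the Dickman function, i.e. the continuous function on $[0,\infty)$ with $\rho(u)=1$ for $0\leq u\leq 1$ and $u\rho'(u)+\rho(u-1)=0$ for $u>1$. *)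

theory Defs
  imports "HOL-Probability.Probability"
begin

text \<open>Values at negative arguments are left unconstrained by this predicate. The derivative is
  only required for \<open>u > 1\<close>, since the function has a corner at \<open>1\<close>.\<close>

definition is_dickman :: "(real \<Rightarrow> real) \<Rightarrow> bool" where
  "is_dickman f \<longleftrightarrow>
     continuous_on {0..} f \<and>
     (\<forall>u\<in>{0..1}. f u = 1) \<and>
     (\<forall>u>1. \<exists>D. (f has_real_derivative D) (at u) \<and> u * D + f (u - 1) = 0)"

text \<open>The value \<open>0\<close> on negative arguments is only there to make the function on \<open>real\<close> unique.\<close>

definition dickman_rho :: "real \<Rightarrow> real" where
  "dickman_rho = (THE f. is_dickman f \<and> (\<forall>u<0. f u = 0))"

definition indep_poisson_seq :: "'a measure \<Rightarrow> (nat \<Rightarrow> 'a \<Rightarrow> nat) \<Rightarrow> bool" where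
  "indep_poisson_seq M Z \<longleftrightarrow>
     prob_space M \<and>
     prob_space.indep_vars M (\<lambda>_. count_space UNIV) Z {1..} \<and>
     (\<forall>j\<ge>1. distr M (count_space UNIV) (Z j) = measure_pmf (poisson_pmf (1 / real j)))"

definition weighted_sum :: "nat \<Rightarrow> (nat \<Rightarrow> nat) \<Rightarrow> nat" where
  "weighted_sum r z = (\<Sum>j=1..r. j * z j)"

lemma is_dickman_unique:
  assumes f: "is_dickman f" and g: "is_dickman g" and "0 \<le> u"
  shows "f u = g u"
proof -
  define d where "d = (\<lambda>u. f u - g u)"
  have cont: "continuous_on {0..} d"
    using f g unfolding d_def is_dickman_def by (intro continuous_on_diff) auto
  have base: "d u = 0" if "0 \<le> u" "u \<le> 1" for u
    using f g that unfolding d_def is_dickman_def by auto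
  have deriv: "(d has_real_derivative - d (u - 1) / u) (at u)" if u: "u > 1" for u
  proof -
    obtain D where D: "(f has_real_derivative D) (at u)" "u * D + f (u - 1) = 0"
      using f u unfolding is_dickman_def by blast
    obtain E where E: "(g has_real_derivative E) (at u)" "u * E + g (u - 1) = 0"
      using g u unfolding is_dickman_def by blast
    have "(d has_real_derivative D - E) (at u)"
      unfolding d_def by (rule DERIV_diff[OF D(1) E(1)])
    moreover have "D - E = - d (u - 1) / u"
      using D(2) E(2) u unfolding d_def by (simp add: field_simps)
    ultimately show ?thesis by simp
  qed
  have "\<forall>u. 0 \<le> u \<and> u \<le> real (Suc k) \<longrightarrow> d u = 0" for k
  proof (induction k)
    case 0
    then show ?case using base by auto
  next
    case (Suc k)
    show ?case
    proof (intro allI impI)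
      fix u assume u: "0 \<le> u \<and> u \<le> real (Suc (Suc k))"
      show "d u = 0"
      proof (cases "u \<le> real (Suc k)")
        case True
        then show ?thesis using Suc u by blast
      next
        case False
        have "continuous_on {real (Suc k)..u} d"
          by (rule continuous_on_subset[OF cont]) auto
        moreover have "(d has_real_derivative 0) (at x)" if "real (Suc k) < x" "x < u" for x
        proof -
          have "d (x - 1) = 0" using Suc that u by auto
          then show ?thesis using deriv[of x] that by auto
        qed
        ultimately have "d u = d (real (Suc k))"
          using DERIV_isconst2[of "real (Suc k)" u d u] False by auto
        then show ?thesis using Suc by auto
      qed
    qed
  qed
  moreover have "u \<le> real (Suc (nat \<lceil>u\<rceil>))" by linarith
  ultimately have "d u = 0" using \<open>0 \<le> u\<close> by blast
  then show ?thesis by (simp add: d_def)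
qed

text \<open>The Picard iterates of \<open>f u = 1 - integral {1..u} (\<lambda>t. f (t - 1) / t)\<close>; the \<open>k\<close>-th one
  is already exact on \<open>{0..real k + 1}\<close>.\<close>

primrec dickman_iter :: "nat \<Rightarrow> real \<Rightarrow> real" where
  "dickman_iter 0 = (\<lambda>u. 1)"
| "dickman_iter (Suc k) = (\<lambda>u. 1 - integral {1..u} (\<lambda>t. dickman_iter k (t - 1) / t))"

lemma dickman_iter_le_1:
  assumes "u \<le> 1"
  shows "dickman_iter k u = 1"
  using assms by (cases k; cases "u = 1") auto

lemma continuous_on_dickman_iter: "continuous_on {0..b} (dickman_iter k)"
proof (induction k arbitrary: b)
  case (Suc k)
  let ?g = "\<lambda>t. dickman_iter k (t - 1) / t"
  have "continuous_on {1..max b 1} (\<lambda>t. dickman_iter k (t - 1))"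
    by (rule continuous_on_compose2[OF Suc[of "max b 1"]]) (auto intro!: continuous_intros)
  then have "continuous_on {1..max b 1} ?g"
    by (intro continuous_intros) auto
  then have "continuous_on {1..max b 1} (\<lambda>u. integral {1..u} ?g)"
    by (intro indefinite_integral_continuous_1 integrable_continuous_real)
  then have 1: "continuous_on {1..max b 1} (dickman_iter (Suc k))"
    by (auto intro!: continuous_intros)
  have 2: "continuous_on {0..1} (dickman_iter (Suc k))"
    by (rule continuous_on_cong[THEN iffD1, OF refl _ continuous_on_const[of _ 1]])
      (metis atLeastAtMost_iff dickman_iter_le_1)
  have "continuous_on ({0..1} \<union> {1..max b 1}) (dickman_iter (Suc k))"
    by (rule continuous_on_closed_Un) (use 1 2 in auto)
  then show ?case
    by (rule continuous_on_subset) auto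
qed simp

lemma dickman_iter_has_derivative:
  assumes "u > 1"
  shows "(dickman_iter (Suc k) has_real_derivative - dickman_iter k (u - 1) / u) (at u)"
proof -
  let ?g = "\<lambda>t. dickman_iter k (t - 1) / t"
  have "continuous_on {1..u + 1} (\<lambda>t. dickman_iter k (t - 1))"
    by (rule continuous_on_compose2[OF continuous_on_dickman_iter[of u]])
      (auto intro!: continuous_intros)
  then have "continuous_on {1..u + 1} ?g"
    by (intro continuous_intros) auto
  then have "((\<lambda>x. integral {1..x} ?g) has_real_derivative ?g u) (at u within {1..u + 1})"
    by (rule integral_has_real_derivative) (use assms in auto)
  then have "((\<lambda>x. integral {1..x} ?g) has_real_derivative ?g u) (at u)"
    using assms by (simp add: at_within_Icc_at)
  then show ?thesis
    by (auto intro!: derivative_eq_intros)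
qed

lemma dickman_iter_Suc_eq: "u \<le> real k + 1 \<Longrightarrow> dickman_iter (Suc k) u = dickman_iter k u"
proof (induction k arbitrary: u)
  case 0
  then show ?case using dickman_iter_le_1[of u] by (simp del: dickman_iter.simps)
next
  case (Suc k)
  have "integral {1..u} (\<lambda>t. dickman_iter (Suc k) (t - 1) / t) =
        integral {1..u} (\<lambda>t. dickman_iter k (t - 1) / t)"
  proof (rule integral_cong)
    fix t assume "t \<in> {1..u}"
    then show "dickman_iter (Suc k) (t - 1) / t = dickman_iter k (t - 1) / t"
      using Suc.IH[of "t - 1"] Suc.prems by simp
  qed
  then show ?case
    unfolding dickman_iter.simps(2)[of "Suc k"] dickman_iter.simps(2)[of k, symmetric]
    by (simp add: dickman_iter.simps)
qed

lemma dickman_iter_eq: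
  assumes "u \<le> real k + 1" "k \<le> m"
  shows "dickman_iter m u = dickman_iter k u"
  using assms(2)
proof (induction m rule: dec_induct)
  case (step m)
  then show ?case using dickman_iter_Suc_eq[of u m] assms(1) by simp
qed simp

lemma is_dickman_exists: "\<exists>f. is_dickman f \<and> (\<forall>u<0. f u = 0)"
proof -
  define f where "f = (\<lambda>u::real. if u < 0 then 0 else dickman_iter (nat \<lceil>u\<rceil>) u)"
  have f_eq: "f u = dickman_iter m u" if "0 \<le> u" "u \<le> real m" for u m
  proof -
    have "nat \<lceil>u\<rceil> \<le> m" "u \<le> real (nat \<lceil>u\<rceil>) + 1"
      using that by linarith+
    then show ?thesis
      using dickman_iter_eq[of u "nat \<lceil>u\<rceil>" m] that by (simp add: f_def)
  qed
  have cont_Icc: "continuous_on {0..real m} f" for m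
    by (rule continuous_on_cong[THEN iffD2, OF refl _ continuous_on_dickman_iter[of _ m]])
      (use f_eq in auto)
  have "continuous (at x within {0..}) f" if "0 \<le> x" for x
  proof -
    define m where "m = Suc (nat \<lceil>x\<rceil>)"
    have m: "x < real m" unfolding m_def by linarith
    have "continuous (at x within {0..real m}) f"
      using cont_Icc[of m] m that by (auto simp: continuous_on_eq_continuous_within)
    moreover have "at x within {0..} = at x within {0..real m}"
      by (rule at_within_nhd[of x "{..<real m}"]) (use m in auto)
    ultimately show ?thesis by simp
  qed
  then have "continuous_on {0..} f"
    by (auto simp: continuous_on_eq_continuous_within)
  moreover have "f u = 1" if "u \<in> {0..1}" for u
    using f_eq[of u 1] dickman_iter_le_1[of u 1] that by (simp del: dickman_iter.simps)
  moreover have "\<exists>D. (f has_real_derivative D) (at u) \<and> u * D + f (u - 1) = 0" if "u > 1" for u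
  proof -
    define m where "m = Suc (nat \<lceil>u\<rceil>)"
    have m: "u < real m" unfolding m_def by linarith
    have "(f has_real_derivative - dickman_iter m (u - 1) / u) (at u)"
    proof (rule has_field_derivative_transform_within_open[OF dickman_iter_has_derivative])
      show "dickman_iter (Suc m) x = f x" if "x \<in> {0<..<real m}" for x
        using f_eq[of x "Suc m"] that by auto
    qed (use m that in auto)
    moreover have "f (u - 1) = dickman_iter m (u - 1)"
      using f_eq[of "u - 1" m] m that by auto
    ultimately show ?thesis
      using that by (intro exI[of _ "- dickman_iter m (u - 1) / u"]) auto
  qed
  ultimately have "is_dickman f" unfolding is_dickman_def by blast
  then show ?thesis by (intro exI[of _ f]) (simp add: f_def)
qed

lemma dickman_rho: "is_dickman dickman_rho" "u < 0 \<Longrightarrow> dickman_rho u = 0"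
proof -
  have "\<exists>!f. is_dickman f \<and> (\<forall>u<0. f u = 0)"
  proof (rule ex_ex1I[OF is_dickman_exists])
    fix f g
    assume *: "is_dickman f \<and> (\<forall>u<0. f u = 0)" "is_dickman g \<and> (\<forall>u<0. g u = 0)"
    show "f = g"
    proof
      show "f u = g u" for u
        using * is_dickman_unique[of f g u] by (cases "u < 0") auto
    qed
  qed
  from theI'[OF this] show "is_dickman dickman_rho" "u < 0 \<Longrightarrow> dickman_rho u = 0"
    unfolding dickman_rho_def by blast+
qed

end

theory Submission
  imports Defs
begin

unbundle no vec_syntax
unbundle fps_syntax

text \<open>The generating function of \<open>b n = P(l_r = n)\<close> shows that \<open>n * b n\<close> is the sum of \<open>b (n - j)\<close> over
  \<open>1 \<le> j \<le> r\<close>, the discrete analogue of \<open>u * \<rho> u = \<integral> \<rho>\<close> over \<open>[u - 1, u]\<close>. As \<open>\<rho>\<close> is decreasing, comparing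
  sums with integrals yields by induction
  \<open>b 0 * \<rho> (n / r) \<le> b n \<le> b 0 * \<rho> (n / (r + 1))\<close>, where \<open>b 0 = exp (- harm r)\<close> is
  \<open>exp (- \<gamma>) / r\<close> up to a factor \<open>1 + O(1 / r)\<close>. The two bounds differ by a factor
  \<open>exp (O(n * ln (n / r + 1) / r\<^sup>2))\<close> because \<open>-\<rho>' / \<rho>\<close> at \<open>u\<close> is \<open>O(ln (u + 1))\<close>; this follows from the
  log-concavity of \<open>\<rho>\<close>.\<close>

section \<open>The Dickman function\<close>

lemma continuous_on_dickman_rho: "S \<subseteq> {0..} \<Longrightarrow> continuous_on S dickman_rho"
  using dickman_rho(1) continuous_on_subset unfolding is_dickman_def by blast

lemma dickman_rho_eq_1: "0 \<le> u \<Longrightarrow> u \<le> 1 \<Longrightarrow> dickman_rho u = 1"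
  using dickman_rho(1) unfolding is_dickman_def by auto

lemma dickman_rho_has_derivative:
  assumes "u > 1"
  shows "(dickman_rho has_real_derivative - dickman_rho (u - 1) / u) (at u)"
proof -
  obtain D where D: "(dickman_rho has_real_derivative D) (at u)" "u * D + dickman_rho (u - 1) = 0"
    using dickman_rho(1) assms unfolding is_dickman_def by blast
  have "D = - dickman_rho (u - 1) / u"
    using D(2) assms by (simp add: field_simps)
  with D(1) show ?thesis by simp
qed

section \<open>The window integral of \<open>dickman_rho\<close>, positivity and
  monotonicity\<close>

definition dickman_int :: "real \<Rightarrow> real" where
  "dickman_int x = integral {0..x} dickman_rho"

lemma continuous_on_dickman_int: "continuous_on {0..b} dickman_int"
  unfolding dickman_int_def
  by (intro indefinite_integral_continuous_1 integrable_continuous_real continuous_on_dickman_rho) auto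

lemma dickman_int_has_derivative:
  assumes "x > 0"
  shows "(dickman_int has_real_derivative dickman_rho x) (at x)"
proof -
  have "(dickman_int has_real_derivative dickman_rho x) (at x within {0..x + 1})"
    unfolding dickman_int_def
    by (rule integral_has_real_derivative) (use assms in \<open>auto intro!: continuous_on_dickman_rho\<close>)
  then show ?thesis
    using assms by (simp add: at_within_Icc_at)
qed

lemma dickman_int_0: "dickman_int 0 = 0"
  by (simp add: dickman_int_def)

lemma dickman_int_1: "dickman_int 1 = 1"
proof -
  have "integral {0..1} dickman_rho = integral {0..1} (\<lambda>_::real. 1::real)"
    by (rule integral_cong) (simp add: dickman_rho_eq_1)
  then show ?thesis by (simp add: dickman_int_def)
qed

text \<open>The delay equation in integrated form: for \<open>x > 1\<close> both sides have
  derivative \<open>dickman_rho x - dickman_rho (x - 1)\<close>, and at \<open>1\<close> both equal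
  \<open>1\<close>.\<close>

lemma dickman_int_window:
  assumes "u \<ge> 1"
  shows "dickman_int u - dickman_int (u - 1) = u * dickman_rho u"
proof (cases "u = 1")
  case True
  then show ?thesis
    by (simp add: dickman_int_0 dickman_int_1 dickman_rho_eq_1)
next
  case False
  define V where "V = (\<lambda>x. x * dickman_rho x - (dickman_int x - dickman_int (x - 1)))"
  have "continuous_on {1..u} (\<lambda>x. dickman_int (x - 1))"
    by (rule continuous_on_compose2[OF continuous_on_dickman_int[of u]])
       (auto intro!: continuous_intros)
  moreover have "continuous_on {1..u} dickman_int"
    by (rule continuous_on_subset[OF continuous_on_dickman_int[of u]]) auto
  ultimately have "continuous_on {1..u} V"
    unfolding V_def by (intro continuous_intros continuous_on_dickman_rho) auto
  moreover have "(V has_real_derivative 0) (at x)" if x: "1 < x" "x < u" for x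
  proof -
    have "((\<lambda>x. dickman_int (x - 1)) has_real_derivative dickman_rho (x - 1) * 1) (at x)"
      by (rule DERIV_chain2[OF dickman_int_has_derivative])
         (use x in \<open>auto intro!: derivative_eq_intros\<close>)
    then show ?thesis
      unfolding V_def using x dickman_rho_has_derivative[of x] dickman_int_has_derivative[of x]
      by (auto intro!: derivative_eq_intros)
  qed
  ultimately have "V u = V 1"
    using DERIV_isconst_end[of 1 u V] assms False by auto
  then show ?thesis
    by (simp add: V_def dickman_int_0 dickman_int_1 dickman_rho_eq_1)
qed

text \<open>At the least point \<open>x\<close> of failure, which lies beyond \<open>1\<close>,
  positivity on \<open>[0, x)\<close> makes the integral over \<open>[x - 1, x]\<close> positive;
  but that integral is \<open>x * dickman_rho x\<close>.\<close>

lemma dickman_rho_pos: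
  assumes "u \<ge> 0"
  shows "dickman_rho u > 0"
proof (rule ccontr)
  assume neg: "\<not> dickman_rho u > 0"
  define S where "S = {x \<in> {0..u}. dickman_rho x \<le> 0}"
  have "closed S"
    unfolding S_def
    by (rule continuous_on_closed_Collect_le) (auto intro!: continuous_on_dickman_rho)
  moreover have "bounded S"
    by (rule bounded_subset[of "{0..u}"]) (auto simp: S_def)
  moreover have "u \<in> S"
    using neg assms by (auto simp: S_def)
  ultimately obtain x where x: "x \<in> S" "\<And>y. y \<in> S \<Longrightarrow> x \<le> y"
    using compact_attains_inf[of S] by (metis compact_eq_bounded_closed empty_iff)
  have before: "dickman_rho y > 0" if "0 \<le> y" "y < x" for y
    using x(1) x(2)[of y] that by (fastforce simp: S_def not_le[symmetric])
  have "x > 1"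
    using x(1) dickman_rho_eq_1[of x] by (force simp: S_def)
  have "dickman_int (x - 1) < dickman_int x"
  proof (rule DERIV_pos_imp_increasing_open[where f = dickman_int])
    show "\<exists>D. (dickman_int has_real_derivative D) (at t) \<and> 0 < D" if "x - 1 < t" "t < x" for t
      using before[of t] dickman_int_has_derivative[of t] that \<open>x > 1\<close> by auto
    show "continuous_on {x - 1..x} dickman_int"
      by (rule continuous_on_subset[OF continuous_on_dickman_int[of x]]) (use \<open>x > 1\<close> in auto)
  qed simp
  then have "x * dickman_rho x > 0"
    using dickman_int_window[of x] \<open>x > 1\<close> by simp
  then show False
    using x(1) \<open>x > 1\<close> by (auto simp: S_def zero_less_mult_iff)
qed

lemma dickman_rho_strict_antimono:
  assumes "1 \<le> x" "x < y"
  shows "dickman_rho y < dickman_rho x"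
proof (rule DERIV_neg_imp_decreasing_open[OF assms(2)])
  show "\<exists>D. (dickman_rho has_real_derivative D) (at t) \<and> D < 0" if "x < t" "t < y" for t
    using dickman_rho_has_derivative[of t] dickman_rho_pos[of "t - 1"] that assms
    by (auto intro!: exI[of _ "- dickman_rho (t - 1) / t"] divide_pos_pos)
qed (use assms in \<open>auto intro!: continuous_on_dickman_rho\<close>)

lemma dickman_rho_antimono:
  assumes "0 \<le> x" "x \<le> y"
  shows "dickman_rho y \<le> dickman_rho x"
proof -
  \<comment> \<open>On \<open>[0, 1]\<close> the function is constant, so \<open>x\<close> may be
    replaced by \<open>max x 1\<close>, from where strict decrease is available.\<close>
  have "dickman_rho y \<le> dickman_rho (max x 1)" if "y \<ge> 1"
    using dickman_rho_strict_antimono[of "max x 1" y] assms that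
    by (cases "y = max x 1") (auto simp: max_def split: if_splits)
  then show ?thesis
    using assms dickman_rho_eq_1[of x] dickman_rho_eq_1[of y] dickman_rho_eq_1[of 1]
    by (cases "y \<ge> 1"; cases "x \<ge> 1") auto
qed

text \<open>The mean of a decreasing integrand lies between its end values. These are the one-cell
  estimates for the Riemann sums below.\<close>

lemma dickman_int_diff_bounds:
  assumes "0 \<le> x" "x \<le> y"
  shows "(y - x) * dickman_rho y \<le> dickman_int y - dickman_int x"
    and "dickman_int y - dickman_int x \<le> (y - x) * dickman_rho x"
proof -
  have "(y - x) * dickman_rho y \<le> dickman_int y - dickman_int x \<and>
        dickman_int y - dickman_int x \<le> (y - x) * dickman_rho x"
  proof (cases "x = y")
    case False
    then have "x < y" using assms by simp
    moreover have "continuous_on {x..y} dickman_int"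
      by (rule continuous_on_subset[OF continuous_on_dickman_int[of y]]) (use assms in auto)
    moreover have "dickman_int differentiable (at t)" if "x < t" for t
      using dickman_int_has_derivative[of t] assms that by (auto simp: real_differentiable_def)
    ultimately obtain l z where z: "x < z" "z < y" "(dickman_int has_real_derivative l) (at z)"
        "dickman_int y - dickman_int x = (y - x) * l"
      using MVT[of x y dickman_int] by blast
    have "l = dickman_rho z"
      using DERIV_unique[OF z(3) dickman_int_has_derivative] z assms by simp
    then show ?thesis
      using z assms by (auto intro!: mult_left_mono dickman_rho_antimono)
  qed simp
  then show "(y - x) * dickman_rho y \<le> dickman_int y - dickman_int x"
    and "dickman_int y - dickman_int x \<le> (y - x) * dickman_rho x" by auto
qed

section \<open>The logarithmic decay rate \<open>-\<rho>'/\<rho>\<close> and log-concavity of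
  \<rho>\<close>

definition dickman_decay :: "real \<Rightarrow> real" where
  "dickman_decay u = dickman_rho (u - 1) / (u * dickman_rho u)"

lemma dickman_decay_pos: "u \<ge> 1 \<Longrightarrow> dickman_decay u > 0"
  unfolding dickman_decay_def by (intro divide_pos_pos mult_pos_pos dickman_rho_pos) auto

lemma continuous_on_dickman_rho_shift: "continuous_on {1..} (\<lambda>x. dickman_rho (x - 1))"
  by (rule continuous_on_compose2[OF continuous_on_dickman_rho[of "{0..}"]])
     (auto intro!: continuous_intros)

lemma continuous_on_dickman_decay: "continuous_on {1..} dickman_decay"
proof -
  have "u * dickman_rho u \<noteq> 0" if "u \<ge> 1" for u
    using dickman_rho_pos[of u] that by auto
  then show ?thesis
    unfolding dickman_decay_def
    by (intro continuous_intros continuous_on_dickman_rho_shift continuous_on_dickman_rho) auto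
qed

lemma ln_dickman_rho_has_derivative:
  assumes "u > 1"
  shows "((\<lambda>x. ln (dickman_rho x)) has_real_derivative - dickman_decay u) (at u)"
  using dickman_rho_pos[of u] dickman_rho_has_derivative[of u] assms
  by (auto intro!: derivative_eq_intros simp: dickman_decay_def)

text \<open>For \<open>u > 2\<close> the quotient rule, with the delay equation at \<open>u\<close>
  and \<open>u - 1\<close>, leaves this factor times a positive quantity, so it carries the sign of
  the derivative of \<open>dickman_decay\<close>.\<close>

definition decay_sign :: "real \<Rightarrow> real" where
  "decay_sign u = dickman_rho (u - 1) - dickman_rho u - dickman_decay (u - 1) * (u * dickman_rho u)"

lemma dickman_decay_has_derivative:
  assumes "u > 2"
  shows "(dickman_decay has_real_derivative
           dickman_rho (u - 1) * decay_sign u / (u * dickman_rho u)\<^sup>2) (at u)"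
proof -
  have pos: "dickman_rho u > 0" "dickman_rho (u - 1) > 0"
    using assms by (auto intro!: dickman_rho_pos)
  have "((\<lambda>x. dickman_rho (x - 1)) has_real_derivative - dickman_rho (u - 1 - 1) / (u - 1) * 1) (at u)"
    by (rule DERIV_chain2[OF dickman_rho_has_derivative])
       (use assms in \<open>auto intro!: derivative_eq_intros\<close>)
  moreover have "- dickman_rho (u - 1 - 1) / (u - 1) * 1 = - dickman_decay (u - 1) * dickman_rho (u - 1)"
    using pos by (simp add: dickman_decay_def)
  ultimately have shift: "((\<lambda>x. dickman_rho (x - 1)) has_real_derivative
      - dickman_decay (u - 1) * dickman_rho (u - 1)) (at u)"
    by simp
  have "((\<lambda>x. x * dickman_rho x) has_real_derivative dickman_rho u - dickman_rho (u - 1)) (at u)"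
    using dickman_rho_has_derivative[of u] assms by (auto intro!: derivative_eq_intros)
  from DERIV_divide[OF shift this] show ?thesis
    using pos assms
    by (simp add: dickman_decay_def[abs_def] decay_sign_def power2_eq_square algebra_simps)
qed

text \<open>On this interval the numerator \<open>dickman_rho (u - 1)\<close> is constantly
  \<open>1\<close>, while the denominator \<open>u * dickman_rho u\<close> has derivative
  \<open>dickman_rho u - 1 < 0\<close> inside it.\<close>

lemma dickman_decay_strict_mono_12:
  assumes "1 \<le> a" "a < b" "b \<le> 2"
  shows "dickman_decay a < dickman_decay b"
proof -
  have "b * dickman_rho b < a * dickman_rho a"
  proof (rule DERIV_neg_imp_decreasing_open[OF assms(2)])
    fix t assume t: "a < t" "t < b"
    have "((\<lambda>x. x * dickman_rho x) has_real_derivative dickman_rho t - dickman_rho (t - 1)) (at t)"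
      using dickman_rho_has_derivative[of t] assms t by (auto intro!: derivative_eq_intros)
    moreover have "dickman_rho (t - 1) = 1" "dickman_rho t < 1"
      using dickman_rho_eq_1[of "t - 1"] dickman_rho_strict_antimono[of 1 t] dickman_rho_eq_1[of 1]
        assms t by auto
    ultimately show "\<exists>D. ((\<lambda>x. x * dickman_rho x) has_real_derivative D) (at t) \<and> D < 0"
      by (intro exI[of _ "dickman_rho t - dickman_rho (t - 1)"]) auto
  qed (use assms in \<open>auto intro!: continuous_intros continuous_on_dickman_rho\<close>)
  moreover have "b * dickman_rho b > 0"
    using dickman_rho_pos[of b] assms by auto
  moreover have "dickman_rho (a - 1) = 1" "dickman_rho (b - 1) = 1"
    using assms by (auto intro!: dickman_rho_eq_1)
  ultimately show ?thesis
    unfolding dickman_decay_def by (simp add: frac_less2)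
qed

text \<open>The sign condition is assumed only below \<open>x\<close>, as suits a first-failure
  argument. Monotonicity on \<open>[1, 2]\<close> and beyond \<open>2\<close> is glued at
  \<open>2\<close>.\<close>

lemma dickman_decay_strict_mono_upto:
  assumes x: "\<And>t. 2 < t \<Longrightarrow> t < x \<Longrightarrow> decay_sign t > 0"
    and ab: "1 \<le> a" "a < b" "b \<le> x"
  shows "dickman_decay a < dickman_decay b"
proof -
  have upper: "dickman_decay a < dickman_decay b" if "2 \<le> a" "a < b" "b \<le> x" for a b
  proof (rule DERIV_pos_imp_increasing_open[OF that(2)])
    fix t assume t: "a < t" "t < b"
    have "0 < dickman_rho (t - 1) * decay_sign t / (t * dickman_rho t)\<^sup>2"
      using x[of t] t that dickman_rho_pos[of "t - 1"] dickman_rho_pos[of t]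
      by (intro divide_pos_pos mult_pos_pos zero_less_power) auto
    then show "\<exists>D. (dickman_decay has_real_derivative D) (at t) \<and> 0 < D"
      using dickman_decay_has_derivative[of t] t that by auto
  next
    show "continuous_on {a..b} dickman_decay"
      by (rule continuous_on_subset[OF continuous_on_dickman_decay]) (use that in auto)
  qed
  consider "b \<le> 2" | "2 \<le> a" | "a < 2" "2 < b" by linarith
  then show ?thesis
  proof cases
    case 3
    then show ?thesis
      using dickman_decay_strict_mono_12[of a 2] upper[of 2 b] ab by force
  qed (use ab dickman_decay_strict_mono_12 upper in auto)
qed

text \<open>Log-concavity of \<open>\<rho>\<close>: at a first zero \<open>x\<close> of \<open>decay_sign\<close>, the decay rate \<open>h = -\<rho>'/\<rho>\<close> would still
  be strictly increasing on \<open>[x - 1, x]\<close>, which makes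
  \<open>decay_sign x = \<integral> (h t - h (x - 1)) * \<rho> t dt\<close> over that window positive.\<close>

lemma decay_sign_pos:
  assumes "u \<ge> 2"
  shows "decay_sign u > 0"
proof (rule ccontr)
  assume neg: "\<not> decay_sign u > 0"
  define S where "S = {x \<in> {2..u}. decay_sign x \<le> 0}"
  have "continuous_on {2..u} (\<lambda>x. dickman_decay (x - 1))"
    by (rule continuous_on_compose2[OF continuous_on_dickman_decay]) (auto intro!: continuous_intros)
  moreover have "continuous_on {2..u} (\<lambda>x. dickman_rho (x - 1))"
    by (rule continuous_on_subset[OF continuous_on_dickman_rho_shift]) auto
  ultimately have "continuous_on {2..u} decay_sign"
    unfolding decay_sign_def[abs_def] by (intro continuous_intros continuous_on_dickman_rho) auto
  then have "closed S"
    unfolding S_def by (intro continuous_on_closed_Collect_le) auto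
  moreover have "bounded S"
    by (rule bounded_subset[of "{2..u}"]) (auto simp: S_def)
  moreover have "u \<in> S"
    using neg assms by (auto simp: S_def)
  ultimately obtain x where x: "x \<in> S" "\<And>y. y \<in> S \<Longrightarrow> x \<le> y"
    using compact_attains_inf[of S] by (metis compact_eq_bounded_closed empty_iff)
  have x2: "x \<ge> 2" using x(1) by (simp add: S_def)
  have before: "decay_sign t > 0" if "2 < t" "t < x" for t
    using x(1) x(2)[of t] that by (fastforce simp: S_def not_le[symmetric])
  define c where "c = dickman_decay (x - 1)"
  \<comment> \<open>\<open>W\<close> is an antiderivative of
    \<open>(dickman_decay t - c) * dickman_rho t\<close>.\<close>
  define W where "W = (\<lambda>t. - dickman_rho t - c * dickman_int t)"
  have "W (x - 1) < W x"
  proof (rule DERIV_pos_imp_increasing_open[where f = W])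
    fix t assume t: "x - 1 < t" "t < x"
    have "(W has_real_derivative dickman_rho (t - 1) / t - c * dickman_rho t) (at t)"
      unfolding W_def using t x2 dickman_rho_has_derivative[of t] dickman_int_has_derivative[of t]
      by (auto intro!: derivative_eq_intros)
    moreover have "dickman_rho t > 0"
      using t x2 by (auto intro!: dickman_rho_pos)
    moreover have "c < dickman_decay t"
      unfolding c_def by (rule dickman_decay_strict_mono_upto[of x]) (use before t x2 in auto)
    ultimately show "\<exists>D. (W has_real_derivative D) (at t) \<and> 0 < D"
      using t x2
      by (intro exI[of _ "dickman_rho (t - 1) / t - c * dickman_rho t"])
         (simp add: dickman_decay_def pos_less_divide_eq field_simps)
  next
    have "continuous_on {x - 1..x} dickman_int"
      by (rule continuous_on_subset[OF continuous_on_dickman_int[of x]]) (use x2 in auto)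
    then show "continuous_on {x - 1..x} W"
      unfolding W_def by (intro continuous_intros continuous_on_dickman_rho) (use x2 in auto)
  qed simp
  moreover have "decay_sign x = W x - W (x - 1)"
    using dickman_int_window[of x] x2 by (simp add: decay_sign_def W_def c_def algebra_simps)
  ultimately show False
    using x(1) by (simp add: S_def)
qed

lemma dickman_decay_mono: "1 \<le> a \<Longrightarrow> a \<le> b \<Longrightarrow> dickman_decay a \<le> dickman_decay b"
  using dickman_decay_strict_mono_upto[of b a b] decay_sign_pos by (cases "a = b") force+

text \<open>By the mean value theorem the slope of \<open>ln \<rho>\<close> is
  \<open>- dickman_decay z\<close> at an interior point; monotonicity of the decay rate moves
  \<open>z\<close> to either end.\<close>

lemma ln_dickman_rho_diff:
  assumes "1 \<le> a" "a \<le> b"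
  shows "(b - a) * dickman_decay a \<le> ln (dickman_rho a) - ln (dickman_rho b)"
    and "ln (dickman_rho a) - ln (dickman_rho b) \<le> (b - a) * dickman_decay b"
proof -
  have "(b - a) * dickman_decay a \<le> ln (dickman_rho a) - ln (dickman_rho b) \<and>
        ln (dickman_rho a) - ln (dickman_rho b) \<le> (b - a) * dickman_decay b"
  proof (cases "a = b")
    case False
    then have "a < b" using assms by simp
    moreover have "continuous_on {a..b} (\<lambda>x. ln (dickman_rho x))"
    proof (intro continuous_on_ln continuous_on_dickman_rho ballI)
      show "dickman_rho x \<noteq> 0" if "x \<in> {a..b}" for x
        using dickman_rho_pos[of x] assms that by auto
    qed (use assms in auto)
    moreover have "(\<lambda>x. ln (dickman_rho x)) differentiable (at t)" if "a < t" for t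
      using ln_dickman_rho_has_derivative[of t] assms that by (auto simp: real_differentiable_def)
    ultimately obtain l z where z: "a < z" "z < b"
        "((\<lambda>x. ln (dickman_rho x)) has_real_derivative l) (at z)"
        "ln (dickman_rho b) - ln (dickman_rho a) = (b - a) * l"
      using MVT[of a b "\<lambda>x. ln (dickman_rho x)"] by blast
    have "l = - dickman_decay z"
      using DERIV_unique[OF z(3) ln_dickman_rho_has_derivative] z assms by simp
    then have "ln (dickman_rho a) - ln (dickman_rho b) = (b - a) * dickman_decay z"
      using z(4) by (simp add: algebra_simps)
    then show ?thesis
      using z assms by (auto intro!: mult_left_mono dickman_decay_mono)
  qed simp
  then show "(b - a) * dickman_decay a \<le> ln (dickman_rho a) - ln (dickman_rho b)"
    and "ln (dickman_rho a) - ln (dickman_rho b) \<le> (b - a) * dickman_decay b" by auto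
qed

text \<open>With \<open>v = u + 1/2\<close>, keeping only the left half of the window \<open>[v - 1, v]\<close> gives
  \<open>\<rho> u \<le> 2 * v * \<rho> v\<close>; as \<open>-\<rho>'/\<rho>\<close> is increasing, this bounds it at \<open>u\<close>.\<close>

lemma dickman_decay_le:
  assumes "u \<ge> 1"
  shows "dickman_decay u \<le> 4 * ln (u + 1)"
proof -
  define v where "v = u + 1 / 2"
  have v: "v \<ge> 1" "v - 1 / 2 = u" "v - 1 = u - 1 / 2" using assms by (auto simp: v_def)
  have "1 / 2 * dickman_rho u \<le> dickman_int (v - 1 / 2) - dickman_int (v - 1)"
    using dickman_int_diff_bounds(1)[of "u - 1 / 2" u] assms unfolding v by simp
  also have "\<dots> \<le> dickman_int v - dickman_int (v - 1)"
    using dickman_int_diff_bounds(1)[of u v] dickman_rho_pos[of v] assms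
    unfolding v by (simp add: v_def)
  also have "\<dots> = v * dickman_rho v"
    by (rule dickman_int_window[OF v(1)])
  finally have "dickman_rho u \<le> 2 * v * dickman_rho v" by simp
  then have "ln (dickman_rho u) \<le> ln (2 * v * dickman_rho v)"
    using dickman_rho_pos[of u] assms by (subst ln_le_cancel_iff) auto
  also have "\<dots> = ln (2 * v) + ln (dickman_rho v)"
    using dickman_rho_pos[of v] v by (subst ln_mult_pos) auto
  finally have "ln (dickman_rho u) - ln (dickman_rho v) \<le> ln (2 * v)" by simp
  moreover have "1 / 2 * dickman_decay u \<le> ln (dickman_rho u) - ln (dickman_rho v)"
    using ln_dickman_rho_diff(1)[of u v] assms by (simp add: v_def)
  \<comment> \<open>The square gives \<open>ln (2 * v) \<le> 2 * ln (u + 1)\<close>; the step length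
    \<open>1 / 2\<close> doubles this to the constant \<open>4\<close>.\<close>
  moreover have "2 * v \<le> (u + 1)\<^sup>2"
    using assms by (simp add: v_def power2_eq_square algebra_simps)
  then have "ln (2 * v) \<le> ln ((u + 1)\<^sup>2)"
    using v by simp
  moreover have "ln ((u + 1)\<^sup>2) = 2 * ln (u + 1)"
    using assms by (simp add: ln_realpow)
  ultimately show ?thesis by linarith
qed

text \<open>Integrates the decay bound from \<open>a\<close> to \<open>b\<close>, in order to
  compare the scales \<open>r + 1\<close> and \<open>r\<close>. A start below \<open>1\<close> is
  moved to \<open>1\<close>, as \<rho> is constant up to there.\<close>

lemma dickman_rho_ratio_le:
  assumes "0 \<le> a" "a \<le> b" "1 \<le> b"
  shows "dickman_rho a \<le> dickman_rho b * exp ((b - a) * (4 * ln (b + 1)))"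
proof -
  have "dickman_rho a = dickman_rho (max a 1)"
    using assms dickman_rho_eq_1[of a] dickman_rho_eq_1[of 1] by (auto simp: max_def)
  moreover have "ln (dickman_rho (max a 1)) - ln (dickman_rho b) \<le> (b - a) * (4 * ln (b + 1))"
  proof -
    have "ln (dickman_rho (max a 1)) - ln (dickman_rho b) \<le> (b - max a 1) * dickman_decay b"
      using ln_dickman_rho_diff(2)[of "max a 1" b] assms by simp
    also have "\<dots> \<le> (b - a) * (4 * ln (b + 1))"
      using dickman_decay_pos[of b] dickman_decay_le[of b] assms by (intro mult_mono) auto
    finally show ?thesis .
  qed
  moreover have pos: "dickman_rho (max a 1) > 0" "dickman_rho b > 0"
    using assms by (auto intro!: dickman_rho_pos)
  ultimately show ?thesis
    by (metis add.commute diff_le_eq exp_add exp_le_cancel_iff exp_ln)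
qed

section \<open>Comparison with the recursion for the local probabilities\<close>

lemma sum_down_reindex:
  fixes f :: "nat \<Rightarrow> 'b::ab_group_add"
  assumes "m \<le> n"
  shows "(\<Sum>j=1..m. f (n - j + 1) - f (n - j)) = f n - f (n - m)"
  using assms
proof (induction m)
  case (Suc m)
  then have "n - Suc m + 1 = n - m" by simp
  with Suc show ?case by simp
qed simp

text \<open>The window \<open>[n / r - 1, n / r]\<close> splits into \<open>r\<close> cells of
  length \<open>1 / r\<close>. Taking left end values makes the sum an upper Riemann sum.\<close>

lemma sum_dickman_rho_lower:
  fixes n r :: nat
  assumes "r \<ge> 1" "r \<le> n"
  shows "real n * dickman_rho (real n / real r) \<le> (\<Sum>j=1..r. dickman_rho (real (n - j) / real r))"
proof -
  define F where "F = (\<lambda>k. dickman_int (real k / real r))"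
  have "F (n - j + 1) - F (n - j) \<le> dickman_rho (real (n - j) / real r) / real r" for j
    using dickman_int_diff_bounds(2)[of "real (n - j) / real r" "real (n - j + 1) / real r"] assms
    by (simp add: F_def divide_right_mono diff_divide_distrib[symmetric])
  then have "(\<Sum>j=1..r. F (n - j + 1) - F (n - j)) \<le> (\<Sum>j=1..r. dickman_rho (real (n - j) / real r) / real r)"
    by (intro sum_mono)
  also have "(\<Sum>j=1..r. F (n - j + 1) - F (n - j)) = F n - F (n - r)"
    by (rule sum_down_reindex[OF assms(2)])
  also have "\<dots> = real n / real r * dickman_rho (real n / real r)"
  proof -
    have "real (n - r) / real r = real n / real r - 1"
      using assms by (simp add: of_nat_diff diff_divide_distrib)
    then show ?thesis
      using dickman_int_window[of "real n / real r"] assms by (simp add: F_def)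
  qed
  finally show ?thesis
    using assms by (simp add: sum_divide_distrib[symmetric] divide_right_mono field_simps)
qed

text \<open>Enlarging the scale from \<open>r\<close> to \<open>r + 1\<close> leaves room for a window shifted by one, so that
  the sum is a lower Riemann sum.\<close>

lemma sum_dickman_rho_upper:
  fixes n r :: nat
  assumes "r < n"
  shows "(\<Sum>j=1..r. dickman_rho (real (n - j) / real (Suc r))) \<le> real n * dickman_rho (real n / real (Suc r))"
proof -
  define s where "s = Suc r"
  define F where "F = (\<lambda>k. dickman_int (real k / real s))"
  have s: "s > 0" "s \<le> n" using assms by (auto simp: s_def)
  have "dickman_rho (real (n - j) / real s) / real s \<le> F (n - 1 - j + 1) - F (n - 1 - j)"
    if "j \<in> {1..r}" for j
  proof -
    have "n - j = n - 1 - j + 1" using that assms by auto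
    then have eq: "real (n - j) / real s - real (n - 1 - j) / real s = 1 / real s"
      by (simp add: diff_divide_distrib[symmetric])
    show ?thesis
      using dickman_int_diff_bounds(1)[of "real (n - 1 - j) / real s" "real (n - j) / real s"]
        \<open>n - j = _\<close>
      unfolding eq by (simp add: F_def divide_right_mono)
  qed
  then have "(\<Sum>j=1..r. dickman_rho (real (n - j) / real s) / real s)
      \<le> (\<Sum>j=1..r. F (n - 1 - j + 1) - F (n - 1 - j))"
    by (intro sum_mono)
  also have "\<dots> = F (n - 1) - F (n - 1 - r)"
    by (rule sum_down_reindex) (use assms in auto)
  \<comment> \<open>The \<open>r\<close> cells of length \<open>1 / s\<close> fall one cell short of
    a unit window. The nonnegative integral over \<open>[(n - 1) / s, n / s]\<close> completes it,
    since \<open>n - 1 - r = n - s\<close>.\<close>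
  also have "F (n - 1) \<le> F n"
  proof -
    have "real (n - 1) / real s \<le> real n / real s" by (simp add: divide_right_mono)
    moreover have "dickman_rho (real n / real s) > 0" by (intro dickman_rho_pos) simp
    ultimately have "0 \<le> (real n / real s - real (n - 1) / real s) * dickman_rho (real n / real s)"
      by (intro mult_nonneg_nonneg) auto
    then show ?thesis
      using dickman_int_diff_bounds(1)[of "real (n - 1) / real s" "real n / real s"]
        \<open>real (n - 1) / real s \<le> _\<close> by (simp add: F_def)
  qed
  also have "F n - F (n - 1 - r) = real n / real s * dickman_rho (real n / real s)"
  proof -
    have "real (n - 1 - r) / real s = real n / real s - 1"
      using assms by (simp add: s_def of_nat_diff diff_divide_distrib[symmetric] field_simps)
    then show ?thesis
      using dickman_int_window[of "real n / real s"] s by (simp add: F_def)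
  qed
  finally show ?thesis
    using s(1) unfolding s_def[symmetric]
    by (simp add: sum_divide_distrib[symmetric] divide_right_mono field_simps)
qed

text \<open>The two sum estimates say that \<open>dickman_rho (n / r)\<close> is a subsolution and
  \<open>dickman_rho (n / Suc r)\<close> a supersolution of the recursion, so strong induction
  preserves both inequalities.\<close>

lemma window_recursion_bounds:
  fixes b :: "nat \<Rightarrow> real"
  assumes rec: "\<And>n. n \<ge> 1 \<Longrightarrow> real n * b n = (\<Sum>j\<in>{1..min r n}. b (n - j))"
    and "r \<ge> 1" "b 0 \<ge> 0"
  shows "b 0 * dickman_rho (real n / real r) \<le> b n \<and>
         b n \<le> b 0 * dickman_rho (real n / real (Suc r))"
proof (induction n rule: less_induct)
  case (less n)
  show ?case
  proof (cases "n \<le> r")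
    case True
    \<comment> \<open>Up to \<open>r\<close> the recursion makes \<open>b n\<close> the mean of all
      earlier values.\<close>
    have "b n = b 0" using True
    proof (induction n rule: less_induct)
      case (less n)
      show ?case
      proof (cases "n = 0")
        case False
        have "real n * b n = (\<Sum>j\<in>{1..n}. b (n - j))"
          using rec[of n] False less.prems by (simp add: min_def)
        also have "\<dots> = (\<Sum>j\<in>{1..n}. b 0)"
          by (intro sum.cong refl less.IH) (use less.prems in auto)
        finally show ?thesis using False by simp
      qed simp
    qed
    moreover have "dickman_rho (real n / real r) = 1" "dickman_rho (real n / real (Suc r)) = 1"
      using True assms(2) by (auto intro!: dickman_rho_eq_1)
    ultimately show ?thesis by simp
  next
    case False
    then have n: "r < n" by simp
    then have rec': "real n * b n = (\<Sum>j=1..r. b (n - j))"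
      using rec[of n] by (simp add: min_def)
    have "real n * (b 0 * dickman_rho (real n / real r)) = b 0 * (real n * dickman_rho (real n / real r))"
      by simp
    also have "\<dots> \<le> b 0 * (\<Sum>j=1..r. dickman_rho (real (n - j) / real r))"
      using sum_dickman_rho_lower[of r n] assms n by (intro mult_left_mono) auto
    also have "\<dots> \<le> real n * b n"
      unfolding rec' sum_distrib_left by (intro sum_mono conjunct1[OF less.IH]) (use n in auto)
    finally have 1: "b 0 * dickman_rho (real n / real r) \<le> b n"
      using n by (simp add: mult_le_cancel_left)
    have "real n * b n \<le> b 0 * (\<Sum>j=1..r. dickman_rho (real (n - j) / real (Suc r)))"
      unfolding rec' sum_distrib_left by (intro sum_mono conjunct2[OF less.IH]) (use n in auto)
    also have "\<dots> \<le> b 0 * (real n * dickman_rho (real n / real (Suc r)))"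
      using sum_dickman_rho_upper[of r n] assms n by (intro mult_left_mono) auto
    finally have "real n * b n \<le> real n * (b 0 * dickman_rho (real n / real (Suc r)))"
      by (simp add: mult.left_commute)
    then have "b n \<le> b 0 * dickman_rho (real n / real (Suc r))"
      using n by (subst (asm) mult_le_cancel_left_pos) auto
    with 1 show ?thesis by simp
  qed
qed

section \<open>The distribution of the weighted sum\<close>

text \<open>For \<open>k \<ge> 1\<close> this is the probability generating function of
  \<open>k * Z k\<close>, that is \<open>exp ((x^k - 1) / k)\<close>.\<close>

definition scaled_poisson_fps :: "nat \<Rightarrow> real fps" where
  "scaled_poisson_fps k =
     Abs_fps (\<lambda>n. if k dvd n then pmf (poisson_pmf (1 / real k)) (n div k) else 0)"

text \<open>On coefficients this is the Poisson relation
  \<open>(i + 1) * p (i + 1) = p i / k\<close>: the factor \<open>k\<close> in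
  \<open>n + 1 = k * (i + 1)\<close> cancels the mean \<open>1 / k\<close>.\<close>

lemma fps_deriv_scaled_poisson:
  assumes "k \<ge> 1"
  shows "fps_deriv (scaled_poisson_fps k) = scaled_poisson_fps k * fps_X ^ (k - 1)"
proof (rule fps_ext)
  fix n
  show "fps_deriv (scaled_poisson_fps k) $ n = (scaled_poisson_fps k * fps_X ^ (k - 1)) $ n"
  proof (cases "k dvd n + 1")
    case True
    then obtain m where m: "n + 1 = k * m" by blast
    then obtain i where i: "m = Suc i" by (cases m) auto
    have n: "n = k * i + (k - 1)" using m i assms by simp
    have "real (n + 1) = real k * real (Suc i)" using m i by (simp add: algebra_simps flip: of_nat_mult)
    moreover have "real (Suc i) * pmf (poisson_pmf (1 / real k)) (Suc i) =
        pmf (poisson_pmf (1 / real k)) i / real k"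
      using assms by (simp add: field_simps del: of_nat_Suc)
    ultimately have "real (n + 1) * pmf (poisson_pmf (1 / real k)) (Suc i) =
        pmf (poisson_pmf (1 / real k)) i"
      using assms by (simp add: mult.assoc del: of_nat_Suc of_nat_add pmf_poisson)
    moreover have "(n + 1) div k = Suc i" using m i assms by simp
    moreover have "n - (k - 1) = k * i" using n by simp
    ultimately show ?thesis
      using True assms n
      by (simp add: scaled_poisson_fps_def fps_X_power_mult_right_nth del: pmf_poisson)
  next
    case False
    \<comment> \<open>Here both coefficients vanish, because \<open>n - (k - 1)\<close> and
      \<open>n + 1\<close> differ by \<open>k\<close>.\<close>
    have "\<not> k dvd n - (k - 1)" if "n \<ge> k - 1"
    proof
      assume "k dvd n - (k - 1)"
      then have "k dvd (n - (k - 1)) + k" by simp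
      moreover have "(n - (k - 1)) + k = n + 1" using that assms by simp
      ultimately show False using False by simp
    qed
    then show ?thesis
      using False by (auto simp: scaled_poisson_fps_def fps_X_power_mult_right_nth)
  qed
qed

section \<open>Independence, convolution and the recursion for the law of the weighted sum\<close>

context prob_space
begin

context
  fixes Z :: "nat \<Rightarrow> 'a \<Rightarrow> nat"
  assumes indep: "indep_vars (\<lambda>_. count_space UNIV) Z {1..}"
    and law: "\<And>j. j \<ge> 1 \<Longrightarrow> distr M (count_space UNIV) (Z j) = measure_pmf (poisson_pmf (1 / real j))"
begin

lemma random_variable_Z: "j \<ge> 1 \<Longrightarrow> Z j \<in> measurable M (count_space UNIV)"
  using indep unfolding indep_vars_def by auto

lemma prob_Z_eq:
  assumes "j \<ge> 1"
  shows "prob {\<omega> \<in> space M. Z j \<omega> = i} = pmf (poisson_pmf (1 / real j)) i"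
proof -
  have "prob {\<omega> \<in> space M. Z j \<omega> = i} = measure (distr M (count_space UNIV) (Z j)) {i}"
    using random_variable_Z[OF assms]
    by (subst measure_distr) (auto intro!: arg_cong[where f = prob])
  then show ?thesis
    using law[OF assms] by (simp add: measure_pmf_single del: pmf_poisson)
qed

lemma prob_mult_Z_eq:
  assumes "j \<ge> 1"
  shows "prob {\<omega> \<in> space M. j * Z j \<omega> = n} = scaled_poisson_fps j $ n"
proof (cases "j dvd n")
  case True
  then obtain i where "n = j * i" by blast
  then show ?thesis
    using assms prob_Z_eq[OF assms, of i] by (simp add: scaled_poisson_fps_def del: pmf_poisson)
next
  case False
  then have "{\<omega> \<in> space M. j * Z j \<omega> = n} = {}" by auto
  then have "prob {\<omega> \<in> space M. j * Z j \<omega> = n} = 0" by (simp only: measure_empty)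
  with False show ?thesis by (simp add: scaled_poisson_fps_def)
qed

lemma weighted_sum_measurable [measurable]:
  "(\<lambda>\<omega>. weighted_sum k (\<lambda>j. Z j \<omega>)) \<in> measurable M (count_space UNIV)"
proof (induction k)
  case (Suc k)
  have [measurable]: "Z (Suc k) \<in> measurable M (count_space UNIV)"
    by (rule random_variable_Z) simp
  show ?case
    using Suc by (simp add: weighted_sum_def)
qed (simp add: weighted_sum_def)

lemma prob_weighted_sum_joint:
  "prob {\<omega> \<in> space M. weighted_sum k (\<lambda>j. Z j \<omega>) = a \<and> Suc k * Z (Suc k) \<omega> = b} =
   prob {\<omega> \<in> space M. weighted_sum k (\<lambda>j. Z j \<omega>) = a} * prob {\<omega> \<in> space M. Suc k * Z (Suc k) \<omega> = b}"
proof -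
  \<comment> \<open>The sum rule for independent variables is applied to real-valued copies;
    injectivity of the cast brings the result back to \<open>nat\<close>.\<close>
  have "indep_vars (\<lambda>_. borel) (\<lambda>j \<omega>. real (j * Z j \<omega>)) {1..}"
    by (rule indep_vars_compose2[OF indep]) auto
  then have "indep_vars (\<lambda>_. borel) (\<lambda>j \<omega>. real (j * Z j \<omega>)) (insert (Suc k) {1..k})"
    by (rule indep_vars_subset) auto
  then have "indep_var borel (\<lambda>\<omega>. real (Suc k * Z (Suc k) \<omega>))
                       borel (\<lambda>\<omega>. \<Sum>j=1..k. real (j * Z j \<omega>))"
    by (intro indep_vars_sum) auto
  from indep_varD[OF this, of "{real b}" "{real a}"]
  have "prob {\<omega> \<in> space M. real (Suc k * Z (Suc k) \<omega>) = real b \<and> (\<Sum>j=1..k. real (j * Z j \<omega>)) = real a} =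
        prob {\<omega> \<in> space M. real (Suc k * Z (Suc k) \<omega>) = real b} *
        prob {\<omega> \<in> space M. (\<Sum>j=1..k. real (j * Z j \<omega>)) = real a}"
    by (simp add: vimage_def Int_def conj_commute)
  then show ?thesis
    unfolding weighted_sum_def of_nat_sum[symmetric] of_nat_eq_iff by (simp add: ac_simps conj_commute)
qed

definition weighted_sum_fps :: "nat \<Rightarrow> real fps" where
  "weighted_sum_fps k = Abs_fps (\<lambda>n. prob {\<omega> \<in> space M. weighted_sum k (\<lambda>j. Z j \<omega>) = n})"

lemma weighted_sum_fps_0: "weighted_sum_fps 0 = 1"
  by (rule fps_ext) (auto simp: weighted_sum_fps_def weighted_sum_def prob_space)

lemma weighted_sum_fps_Suc:
  "weighted_sum_fps (Suc k) = weighted_sum_fps k * scaled_poisson_fps (Suc k)"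
proof (rule fps_ext)
  fix n
  \<comment> \<open>The event is split by the value \<open>i\<close> of the partial sum;
    \<open>i \<le> n\<close> in the union, so \<open>n - i\<close> is not truncated.\<close>
  define A where "A = (\<lambda>i. {\<omega> \<in> space M. weighted_sum k (\<lambda>j. Z j \<omega>) = i \<and> Suc k * Z (Suc k) \<omega> = n - i})"
  have [measurable]: "Z (Suc k) \<in> measurable M (count_space UNIV)"
    by (rule random_variable_Z) simp
  have "{\<omega> \<in> space M. weighted_sum (Suc k) (\<lambda>j. Z j \<omega>) = n} = (\<Union>i\<in>{0..n}. A i)"
    by (auto simp: A_def weighted_sum_def)
  also have "prob \<dots> = (\<Sum>i=0..n. prob (A i))"
    by (rule finite_measure_finite_Union) (auto simp: A_def disjoint_family_on_def)
  also have "\<dots> = (\<Sum>i=0..n. weighted_sum_fps k $ i * scaled_poisson_fps (Suc k) $ (n - i))"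
    unfolding A_def prob_weighted_sum_joint using prob_mult_Z_eq[of "Suc k"]
    by (simp add: weighted_sum_fps_def)
  finally show "weighted_sum_fps (Suc k) $ n = (weighted_sum_fps k * scaled_poisson_fps (Suc k)) $ n"
    by (simp add: weighted_sum_fps_def fps_mult_nth)
qed

text \<open>Constant coefficients multiply, and factor \<open>j\<close> contributes the Poisson mass
  at \<open>0\<close>, \<open>exp (- 1 / j)\<close>.\<close>

lemma weighted_sum_fps_nth_0: "weighted_sum_fps k $ 0 = exp (- harm k)"
proof (induction k)
  case (Suc k)
  have "scaled_poisson_fps (Suc k) $ 0 = exp (- inverse (real (Suc k)))"
    by (simp add: scaled_poisson_fps_def inverse_eq_divide)
  then show ?case
    using Suc by (simp add: weighted_sum_fps_Suc harm_Suc exp_add[symmetric] del: of_nat_Suc)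
qed (simp add: weighted_sum_fps_0 harm_def)

text \<open>Factor \<open>j\<close> of the product has logarithmic derivative
  \<open>x^(j - 1)\<close>, and the product rule adds these up.\<close>

lemma fps_deriv_weighted_sum:
  "fps_deriv (weighted_sum_fps k) = (\<Sum>j=1..k. weighted_sum_fps k * fps_X ^ (j - 1))"
proof (induction k)
  case (Suc k)
  have "fps_deriv (weighted_sum_fps (Suc k)) =
      weighted_sum_fps k * (scaled_poisson_fps (Suc k) * fps_X ^ k) +
      (\<Sum>j=1..k. weighted_sum_fps k * fps_X ^ (j - 1)) * scaled_poisson_fps (Suc k)"
    using fps_deriv_scaled_poisson[of "Suc k"] by (simp add: weighted_sum_fps_Suc Suc)
  then show ?case
    by (simp add: weighted_sum_fps_Suc sum_distrib_right sum_distrib_left mult_ac)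
qed (simp add: weighted_sum_fps_0)

lemma weighted_sum_recursion:
  assumes "n \<ge> 1"
  shows "real n * weighted_sum_fps r $ n = (\<Sum>j\<in>{1..min r n}. weighted_sum_fps r $ (n - j))"
proof -
  obtain m where m: "n = Suc m" using assms by (cases n) auto
  have "real n * weighted_sum_fps r $ n = fps_deriv (weighted_sum_fps r) $ m"
    by (simp add: m)
  \<comment> \<open>With \<open>m = n - 1\<close>, the shift by \<open>j - 1\<close> turns index
    \<open>m\<close> into \<open>n - j\<close>; the terms with \<open>j > n\<close> vanish.\<close>
  also have "\<dots> = (\<Sum>j=1..r. if m < j - 1 then 0 else weighted_sum_fps r $ (m - (j - 1)))"
    unfolding fps_deriv_weighted_sum by (simp only: fps_sum_nth fps_X_power_mult_right_nth)
  also have "\<dots> = (\<Sum>j\<in>{1..min r n}. weighted_sum_fps r $ (n - j))"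
    by (rule sum.mono_neutral_cong_right) (auto simp: m)
  finally show ?thesis .
qed

lemma prob_weighted_sum_bounds:
  assumes "r \<ge> 1"
  shows "exp (- harm r) * dickman_rho (real n / real r)
           \<le> prob {\<omega> \<in> space M. weighted_sum r (\<lambda>j. Z j \<omega>) = n}"
    and "prob {\<omega> \<in> space M. weighted_sum r (\<lambda>j. Z j \<omega>) = n}
           \<le> exp (- harm r) * dickman_rho (real n / real (Suc r))"
  using window_recursion_bounds[of "\<lambda>n. weighted_sum_fps r $ n" r n] weighted_sum_recursion assms
  unfolding weighted_sum_fps_nth_0 by (auto simp: weighted_sum_fps_def)

end

end

section \<open>Explicit estimates and assembly of the error term\<close>

lemma exp_minus_harm_bounds:
  fixes r :: nat
  assumes "r \<ge> 1"
  shows "exp (- euler_mascheroni) / real r * exp (- (1 / real r)) \<le> exp (- harm r)"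
    and "exp (- harm r) \<le> exp (- euler_mascheroni) / real r"
proof -
  have ln_r: "exp (- euler_mascheroni) / real r = exp (- euler_mascheroni - ln (real r))"
    using assms by (simp add: exp_diff)
  \<comment> \<open>\<open>harm r - ln r\<close> decreases to its limit and so lies above
    it.\<close>
  have "euler_mascheroni \<le> harm r - ln (real r)"
    by (rule LIMSEQ_le_const2[OF euler_mascheroni_LIMSEQ])
       (use euler_mascheroni_sequence_decreasing[of r] assms in auto)
  then show "exp (- harm r) \<le> exp (- euler_mascheroni) / real r"
    unfolding ln_r by simp
  obtain m where m: "r = Suc m" using assms by (cases r) auto
  \<comment> \<open>From the other side, \<open>harm r - ln (r + 1)\<close> stays below the
    limit.\<close>
  have "harm r \<le> euler_mascheroni + ln (real r + 1)"
    using euler_mascheroni_lower[of m] unfolding m by (simp add: add_ac) (smt (verit) divide_nonneg_nonneg of_nat_0_le_iff)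
  moreover have "ln (real r + 1) \<le> ln (real r) + 1 / real r"
  proof -
    have "ln (real r + 1) - ln (real r) = ln (1 + 1 / real r)"
      using assms ln_div[of "real r + 1" "real r"] by (simp add: add_divide_distrib)
    also have "\<dots> \<le> 1 / real r"
      by (rule ln_add_one_self_le_self) simp
    finally show ?thesis by simp
  qed
  ultimately show "exp (- euler_mascheroni) / real r * exp (- (1 / real r)) \<le> exp (- harm r)"
    unfolding ln_r by (simp add: exp_add[symmetric])
qed

text \<open>Multiplying \<open>1 - x \<le> exp (- x)\<close> by \<open>exp x\<close> gives
  \<open>exp x - 1 \<le> x * exp x\<close>. This turns an exponential factor into a relative
  error.\<close>

lemma exp_le_linear:
  fixes x c :: real
  assumes "0 \<le> x" "x \<le> c"
  shows "exp x \<le> 1 + exp c * x"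
proof -
  have "1 - x \<le> exp (- x)" using exp_ge_add_one_self[of "- x"] by simp
  then have "exp x * (1 - x) \<le> exp x * exp (- x)" by (intro mult_left_mono) auto
  then have "exp x \<le> 1 + exp x * x" by (simp add: exp_minus algebra_simps)
  also have "\<dots> \<le> 1 + exp c * x" using assms by (intro add_left_mono mult_right_mono) auto
  finally show ?thesis .
qed

text \<open>The first bound uses \<open>n * ln n \<le> r^2\<close> and keeps the exponents bounded.
  The second absorbs the relative error \<open>1 / r\<close> of \<open>exp (- harm r)\<close>; it
  follows from \<open>n / r \<ge> 1\<close> and \<open>ln 2 \<ge> 1 / 2\<close>.\<close>

lemma error_term_bounds:
  fixes n r :: nat
  assumes "n \<ge> 1" "r \<ge> 1" "sqrt (real n * ln (real n)) \<le> real r" "r \<le> n"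
  shows "real n * ln (real n / real r + 1) / (real r)\<^sup>2 \<le> 2"
    and "1 / real r \<le> 2 * (real n * ln (real n / real r + 1) / (real r)\<^sup>2)"
proof -
  have u: "real n / real r \<ge> 1" using assms by simp
  have ln2: "1 / 2 \<le> ln (2::real)" using ln2_ge_two_thirds by simp
  have "ln 2 \<le> ln (real n / real r + 1)" using u by (subst ln_le_cancel_iff) auto
  with ln2 have lower: "1 / 2 \<le> ln (real n / real r + 1)" by linarith
  have "1 * 1 \<le> real n / real r * (2 * ln (real n / real r + 1))"
    using u lower by (intro mult_mono) auto
  then have "1 / real r * 1 \<le> 1 / real r * (real n / real r * (2 * ln (real n / real r + 1)))"
    by (intro mult_left_mono) auto
  then show "1 / real r \<le> 2 * (real n * ln (real n / real r + 1) / (real r)\<^sup>2)"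
    by (simp add: power2_eq_square mult_ac)
  show "real n * ln (real n / real r + 1) / (real r)\<^sup>2 \<le> 2"
  proof (cases "n = 1")
    \<comment> \<open>Here \<open>r = 1\<close> and the value is \<open>ln 2\<close>; the case is
      separate because \<open>n + 1 \<le> n^2\<close> fails.\<close>
    case True
    then show ?thesis using assms ln_2_less_1 by simp
  next
    case False
    then have n: "real n \<ge> 2" using assms by simp
    have "real n / real r \<le> real n" using assms by (simp add: divide_le_eq)
    moreover have "real n + 1 \<le> (real n)\<^sup>2"
      using mult_right_mono[OF n, of "real n"] n unfolding power2_eq_square by linarith
    ultimately have "ln (real n / real r + 1) \<le> ln ((real n)\<^sup>2)"
      using u by (subst ln_le_cancel_iff) auto
    also have "\<dots> = 2 * ln (real n)" using n by (simp add: ln_realpow)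
    finally have "real n * ln (real n / real r + 1) \<le> real n * (2 * ln (real n))"
      by (intro mult_left_mono) auto
    also have "\<dots> \<le> 2 * (real r)\<^sup>2"
      using real_sqrt_le_iff[of "real n * ln (real n)" "(real r)\<^sup>2"] assms(3) by simp
    finally show ?thesis using assms by (simp add: divide_le_eq)
  qed
qed

theorem theorem3:
  shows "\<exists>C>0. \<forall>(M :: 'a measure) Z. indep_poisson_seq M Z \<longrightarrow>
    (\<forall>n r :: nat. n \<ge> 1 \<longrightarrow> r \<ge> 1 \<longrightarrow>
       sqrt (real n * ln (real n)) \<le> real r \<longrightarrow> r \<le> n \<longrightarrow>
       (\<exists>\<epsilon> :: real.
          measure M {\<omega> \<in> space M. weighted_sum r (\<lambda>j. Z j \<omega>) = n} =
            exp (- euler_mascheroni) / real r * dickman_rho (real n / real r) * (1 + \<epsilon>) \<and>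
          \<bar>\<epsilon>\<bar> \<le> C * real n * ln (real n / real r + 1) / (real r)\<^sup>2))"
proof (rule exI[of _ "4 * exp 8 :: real"], intro conjI allI impI)
  fix M :: "'a measure" and Z :: "nat \<Rightarrow> 'a \<Rightarrow> nat" and n r :: nat
  assume Z: "indep_poisson_seq M Z"
    and nr: "n \<ge> 1" "r \<ge> 1" "sqrt (real n * ln (real n)) \<le> real r" "r \<le> n"
  interpret prob_space M using Z by (simp add: indep_poisson_seq_def)
  define P where "P = prob {\<omega> \<in> space M. weighted_sum r (\<lambda>j. Z j \<omega>) = n}"
  define X where "X = real n * ln (real n / real r + 1) / (real r)\<^sup>2"
  define m where "m = exp (- euler_mascheroni) / real r * dickman_rho (real n / real r)"
  define \<epsilon> where "\<epsilon> = P / m - 1"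
  have X: "X \<le> 2" "1 / real r \<le> 2 * X"
    using error_term_bounds[OF nr] by (simp_all add: X_def)
  have "X \<ge> 0" using X(2) by (smt (verit) divide_nonneg_nonneg of_nat_0_le_iff)
  have rho: "dickman_rho (real n / real r) > 0" by (intro dickman_rho_pos) simp
  then have m: "m > 0" using nr by (auto simp: m_def)
  note P_bounds = prob_weighted_sum_bounds[of Z r n, folded P_def]
  have Z': "indep_vars (\<lambda>_. count_space UNIV) Z {1..}"
      "\<And>j. j \<ge> 1 \<Longrightarrow> distr M (count_space UNIV) (Z j) = measure_pmf (poisson_pmf (1 / real j))"
    using Z by (auto simp: indep_poisson_seq_def)
  \<comment> \<open>From below, the only loss is the factor \<open>exp (- 1 / r)\<close> between
    \<open>exp (- harm r)\<close> and \<open>exp (- \<gamma>) / r\<close>.\<close>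
  have "m * (1 - 1 / real r) \<le> m * exp (- (1 / real r))"
    using m exp_ge_add_one_self[of "- (1 / real r)"] by (intro mult_left_mono) auto
  also have "\<dots> \<le> exp (- harm r) * dickman_rho (real n / real r)"
    using mult_right_mono[OF exp_minus_harm_bounds(1)[OF nr(2)], of "dickman_rho (real n / real r)"] rho
    by (simp add: m_def mult_ac)
  also have "\<dots> \<le> P" by (rule P_bounds(1)[OF Z' nr(2)])
  finally have "1 - 1 / real r \<le> P / m" using m by (simp add: pos_le_divide_eq mult.commute)
  then have lower: "- \<epsilon> \<le> 2 * X" using X(2) by (simp add: \<epsilon>_def)
  have "P \<le> exp (- harm r) * dickman_rho (real n / real (Suc r))"
    by (rule P_bounds(2)[OF Z' nr(2)])
  also have "\<dots> \<le> exp (- euler_mascheroni) / real r * (dickman_rho (real n / real r) * exp (4 * X))"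
  proof (intro mult_mono exp_minus_harm_bounds(2) nr)
    have "dickman_rho (real n / real (Suc r)) \<le> dickman_rho (real n / real r) *
        exp ((real n / real r - real n / real (Suc r)) * (4 * ln (real n / real r + 1)))"
      using nr by (intro dickman_rho_ratio_le divide_left_mono) auto
    also have "\<dots> \<le> dickman_rho (real n / real r) * exp (4 * X)"
    proof -
      \<comment> \<open>The change of scale moves the argument of \<rho> by at most
        \<open>n / r^2\<close>, which times the decay bound is \<open>4 * X\<close>.\<close>
      have "real n / real r - real n / real (Suc r) = real n / (real r * real (Suc r))"
        using nr by (simp add: field_simps)
      also have "\<dots> \<le> real n / (real r * real r)"
        using nr by (intro divide_left_mono mult_left_mono) auto
      finally have "(real n / real r - real n / real (Suc r)) * (4 * ln (real n / real r + 1))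
          \<le> real n / (real r * real r) * (4 * ln (real n / real r + 1))"
        by (intro mult_right_mono) auto
      also have "\<dots> = 4 * X" by (simp add: X_def power2_eq_square)
      finally show ?thesis using rho by (intro mult_left_mono) auto
    qed
    finally show "dickman_rho (real n / real (Suc r)) \<le> dickman_rho (real n / real r) * exp (4 * X)" .
    show "0 \<le> dickman_rho (real n / real (Suc r))"
      using dickman_rho_pos[of "real n / real (Suc r)"] by simp
  qed auto
  also have "\<dots> = m * exp (4 * X)" by (simp add: m_def)
  \<comment> \<open>\<open>X \<le> 2\<close> gives \<open>4 * X \<le> 8\<close>; hence the constant
    \<open>4 * exp 8\<close>.\<close>
  also have "\<dots> \<le> m * (1 + exp 8 * (4 * X))"
    using m X(1) \<open>X \<ge> 0\<close> by (intro mult_left_mono exp_le_linear) auto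
  finally have "P / m \<le> 1 + exp 8 * (4 * X)" using m by (simp add: pos_divide_le_eq mult.commute)
  then have upper: "\<epsilon> \<le> 4 * exp 8 * X" by (simp add: \<epsilon>_def)
  have "2 * X \<le> 4 * exp 8 * X"
    using \<open>X \<ge> 0\<close> one_le_exp_iff[of "8::real"] by (intro mult_right_mono) linarith+
  with lower upper have "\<bar>\<epsilon>\<bar> \<le> 4 * exp 8 * X" by linarith
  moreover have "P = m * (1 + \<epsilon>)" using m by (simp add: \<epsilon>_def)
  ultimately show "\<exists>\<epsilon>. measure M {\<omega> \<in> space M. weighted_sum r (\<lambda>j. Z j \<omega>) = n} =
        exp (- euler_mascheroni) / real r * dickman_rho (real n / real r) * (1 + \<epsilon>) \<and>
      \<bar>\<epsilon>\<bar> \<le> 4 * exp 8 * real n * ln (real n / real r + 1) / (real r)\<^sup>2"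
    by (intro exI[of _ \<epsilon>]) (simp add: P_def m_def X_def mult.assoc)
qed simp

end
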